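(* For every integer $k\ge 1$, the problem $$\min_{Z\in\mathcal S_k}\ \bar a(u-u_Z,u-u_Z)$$ admits at least one solution; that is, there exists $W\in\mathcal S_k$ such that $\bar a(u-u_W,u-u_W)\le \bar a(u-u_Z,u-u_Z)$ for every $Z\in\mathcal S_k$.
   Context: Setting: $H$ is a separable real Hilbert space with norm $\|\cdot\|$, and $H'$ is its dual, with duality pairing $\langle\cdot,\cdot\rangle$. $B_s(H)$ is the space of continuous symmetric bilinear forms on $H$ (with its usual norm). $(\Gamma,\mathcal B,\mu)$ is a $\sigma$-finite measure space. $a\in L^\infty(\Gamma,B_s(H);d\mu)$ is such that there is $\alpha>0$ with $\alpha\|v\|^2\le a(v,v;\gamma)$ for all $v\in H$ and $\mu$-a.e. $\gamma\in\Gamma$, where $a(\cdot,\cdot;\gamma)$ denotes the form $a(\gamma)$. For $v,w\in L^2(\Gamma,H;d\mu)$ set $$\bar a(v,w)=\int_\Gamma a(v(\gamma),w(\gamma);\gamma)\,d\mu(\gamma).$$ $f\in L^2(\Gamma,H';d\mu)$ is given. $u\in L^2(\Gamma,H;d\mu)$ is the unique solution of $\bar a(u,v)=\int_\Gamma\langle f(\gamma),v(\gamma)\rangle\,d\mu(\gamma)$ for all $v\in L^2(\Gamma,H;d\mu)$; equivalently, for $\mu$-a.e. $\gamma$, $a(u(\gamma),v;\gamma)=\langle f(\gamma),v\rangle$ for all $v\in H$. For a closed subspace $Z\subset H$, $u_Z\in L^2(\Gamma,Z;d\mu)$ is the unique solution of $\bar a(u_Z,z)=\int_\Gamma\langle f(\gamma),z(\gamma)\rangle\,d\mu(\gamma)$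 for all $z\in L^2(\Gamma,Z;d\mu)$. $\mathcal S_k$ is the family of all linear subspaces of $H$ of dimension at most $k$. *)

theory Defs
  imports "HOL-Analysis.Analysis"
begin

text \<open>Measurability in the sense of Bochner.  For values in a separable space this is Borel
  measurability, but the space of bilinear forms on an infinite-dimensional Hilbert space is not
  separable.  Convergence is required at every point, not just almost everywhere: the measure need
  not be complete, and an a.e. limit of simple functions need not be measurable (so the library's
  integral of it could be the default value 0).  Every class of a.e. equal functions that is an
  a.e. limit of simple functions has a representative of this kind.\<close>

definition strongly_measurable :: "'g measure \<Rightarrow> ('g \<Rightarrow> 'b::metric_space) \<Rightarrow> bool" where
  "strongly_measurable M f \<longleftrightarrow>
     (\<exists>s. (\<forall>n::nat. simple_function M (s n)) \<and>
          (\<forall>\<gamma>\<in>space M. (\<lambda>n. s n \<gamma>) \<longlonglongrightarrow> f \<gamma>))"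

text \<open>The Bochner spaces of functions with values in a closed subspace \<open>X\<close> of a normed space;
  elements are representatives, so all conditions other than measurability are imposed almost
  everywhere.\<close>

definition bochner_L2 :: "'g measure \<Rightarrow> 'b::real_normed_vector set \<Rightarrow> ('g \<Rightarrow> 'b) set" where
  "bochner_L2 M X =
     {v. strongly_measurable M v \<and> (AE \<gamma> in M. v \<gamma> \<in> X) \<and> integrable M (\<lambda>\<gamma>. (norm (v \<gamma>))\<^sup>2)}"

definition bochner_Linf :: "'g measure \<Rightarrow> 'b::real_normed_vector set \<Rightarrow> ('g \<Rightarrow> 'b) set" where
  "bochner_Linf M X =
     {v. strongly_measurable M v \<and> (AE \<gamma> in M. v \<gamma> \<in> X) \<and> (\<exists>C. AE \<gamma> in M. norm (v \<gamma>) \<le> C)}"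

text \<open>A continuous bilinear form is a curried bounded linear map; the nested operator norm is the
  supremum of \<open>\<bar>b v w\<bar>\<close> over \<open>v\<close>, \<open>w\<close> in the unit ball.\<close>

definition sym_bilinear_forms :: "('h::real_normed_vector \<Rightarrow>\<^sub>L 'h \<Rightarrow>\<^sub>L real) set" where
  "sym_bilinear_forms = {b :: 'h \<Rightarrow>\<^sub>L 'h \<Rightarrow>\<^sub>L real. \<forall>v w. b v w = b w v}"

definition abar :: "'g measure \<Rightarrow> ('g \<Rightarrow> 'h::real_normed_vector \<Rightarrow>\<^sub>L 'h \<Rightarrow>\<^sub>L real) \<Rightarrow>
    ('g \<Rightarrow> 'h) \<Rightarrow> ('g \<Rightarrow> 'h) \<Rightarrow> real" where
  "abar M a v w = (\<integral>\<gamma>. a \<gamma> (v \<gamma>) (w \<gamma>) \<partial>M)"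

definition is_galerkin_solution :: "'g measure \<Rightarrow> ('g \<Rightarrow> 'h::real_normed_vector \<Rightarrow>\<^sub>L 'h \<Rightarrow>\<^sub>L real) \<Rightarrow>
    ('g \<Rightarrow> 'h \<Rightarrow>\<^sub>L real) \<Rightarrow> 'h set \<Rightarrow> ('g \<Rightarrow> 'h) \<Rightarrow> bool" where
  "is_galerkin_solution M a f Z w \<longleftrightarrow>
     w \<in> bochner_L2 M Z \<and>
     (\<forall>z\<in>bochner_L2 M Z. abar M a w z = (\<integral>\<gamma>. f \<gamma> (z \<gamma>) \<partial>M))"

text \<open>The solution is unique as an element of \<open>L\<^sup>2\<close>, i.e. up to null sets; the choice below is
  only that of a representative.  For \<open>Z = UNIV\<close> it solves the full problem.\<close>

definition galerkin_solution :: "'g measure \<Rightarrow> ('g \<Rightarrow> 'h::real_normed_vector \<Rightarrow>\<^sub>L 'h \<Rightarrow>\<^sub>L real) \<Rightarrow>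
    ('g \<Rightarrow> 'h \<Rightarrow>\<^sub>L real) \<Rightarrow> 'h set \<Rightarrow> ('g \<Rightarrow> 'h)" where
  "galerkin_solution M a f Z = (SOME w. is_galerkin_solution M a f Z w)"

text \<open>Finite-dimensionality is stated separately because the library's \<open>dim\<close> is 0 on
  infinite-dimensional subspaces.\<close>

definition subspaces_dim_le :: "nat \<Rightarrow> 'h::real_vector set set" where
  "subspaces_dim_le k =
     {Z. subspace Z \<and> (\<exists>B. finite B \<and> span B = Z) \<and> dim Z \<le> k}"

end

theory Submission
  imports Defs "HOL-Complex_Analysis.Great_Picard"
begin

text \<open>The proof is the direct method of the calculus of variations, with all compactness arguments
  carried out at a fixed parameter \<open>\<gamma>\<close>.

  By Galerkin orthogonality (\<open>galerkin_best_approximation\<close>), the error of the Galerkin solution on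
  \<open>Z\<close> is at most that of any other square integrable field with values in \<open>Z\<close>.  So it suffices to
  find a subspace \<open>W\<close> and some field \<open>w\<close> with values in \<open>W\<close> whose error is at most the infimum.

  Take a minimizing sequence \<open>Z\<^sub>n\<close> and write each \<open>Z\<^sub>n\<close> as the span of \<open>k\<close> vectors that are
  orthonormal or zero.  Since \<open>H\<close> is separable, along a subsequence these vectors converge weakly to
  vectors \<open>l\<^sub>1, \<dots>, l\<^sub>k\<close>, and \<open>W\<close> is their span.  At a fixed \<open>\<gamma>\<close>, elements of the spaces \<open>Z\<^sub>n\<close> with
  bounded error have bounded coefficients, hence weak limit points, and these lie in \<open>W\<close>.  A
  coercive form is weakly lower semicontinuous, so the smallest error attainable in \<open>W\<close> at \<open>\<gamma>\<close> is at
  most the lower limit of the errors along the sequence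
  (\<open>best_approximation_error_le_liminf\<close>).  The subsequence used for the coefficients may depend
  on \<open>\<gamma>\<close>, because only a pointwise inequality is asserted.  Fatou's lemma turns that inequality into
  one between the integrals.

  The argument needs the pointwise best approximation \<open>w\<close> to be measurable in \<open>\<gamma>\<close>, and it needs
  Galerkin solutions to exist.  Both follow from \<open>pointwise_solution_exists\<close>: the pointwise variational
  problem is the minimization of an energy, and choosing the first almost minimizer from a
  fixed enumeration of a countable dense set gives measurable fields that converge to the solution.\<close>

section \<open>Coercive symmetric forms on a Hilbert space\<close>

locale coercive_symmetric_form = bounded_bilinear b
  for b :: "'h::{real_inner, complete_space} \<Rightarrow> 'h \<Rightarrow> real" +
  fixes \<alpha> :: real
  assumes pos: "\<alpha> > 0"
    and coercive: "\<alpha> * (norm v)\<^sup>2 \<le> b v v"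
    and sym: "b v w = b w v"
begin

lemma nonneg: "0 \<le> b v v"
  using coercive[of v] pos by (meson mult_nonneg_nonneg less_imp_le order_trans zero_le_power2)

lemma square_add: "b (v + w) (v + w) = b v v + 2 * b v w + b w w"
  using sym[of w v] by (simp add: add_left add_right)

lemma square_diff: "b (v - w) (v - w) = b v v - 2 * b v w + b w w"
  using sym[of w v] by (simp add: diff_left diff_right)

text \<open>The functional (up to a factor 2) whose minimizer over a subspace solves the variational
  equation \<open>b w z = f z\<close> there.\<close>

definition energy :: "('h \<Rightarrow>\<^sub>L real) \<Rightarrow> 'h \<Rightarrow> real" where
  "energy f z = b z z - 2 * f z"

lemma continuous_on_energy: "continuous_on S (energy f)"
  unfolding energy_def by (intro continuous_intros continuous_on)

lemma energy_bounded_below: "- (norm f)\<^sup>2 / \<alpha> \<le> energy f z"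
proof -
  have "f z \<le> norm f * norm z"
    using norm_blinfun[of f z] by simp
  then have "\<alpha> * (norm z)\<^sup>2 - 2 * (norm f * norm z) \<le> energy f z"
    unfolding energy_def using coercive[of z] by linarith
  moreover have "\<alpha> * (norm z)\<^sup>2 - 2 * (norm f * norm z) + (norm f)\<^sup>2 / \<alpha>
      = \<alpha> * (norm z - norm f / \<alpha>)\<^sup>2"
    using pos by (simp add: power2_eq_square field_simps)
  moreover have "\<alpha> * (norm z - norm f / \<alpha>)\<^sup>2 \<ge> 0"
    using pos by simp
  ultimately show ?thesis by simp
qed

text \<open>By the parallelogram identity, the energy at the midpoint of two points lies below the mean of
  their energies by a quarter of \<open>b (x - y) (x - y)\<close>; almost minimality limits this gain.\<close>

lemma dist_almost_minimizers:
  assumes X: "subspace X" "x \<in> X" "y \<in> X"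
    and x: "\<And>z. z \<in> X \<Longrightarrow> energy f x \<le> energy f z + e"
    and y: "\<And>z. z \<in> X \<Longrightarrow> energy f y \<le> energy f z + d"
  shows "\<alpha> * (norm (x - y))\<^sup>2 \<le> 2 * (e + d)"
proof -
  define m where "m = (1/2) *\<^sub>R (x + y)"
  have "m \<in> X"
    unfolding m_def by (intro subspace_scale subspace_add X)
  have fm: "f m = (f x + f y) / 2"
    unfolding m_def by (simp add: blinfun.bilinear_simps)
  have bm: "b m m = (b x x + 2 * b x y + b y y) / 4"
    unfolding m_def by (simp add: scaleR_left scaleR_right square_add)
  have "b (x - y) (x - y) = 2 * energy f x + 2 * energy f y - 4 * energy f m"
    unfolding square_diff energy_def fm bm by (simp add: field_simps)
  also have "\<dots> \<le> 2 * (e + d)"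
    using x[OF \<open>m \<in> X\<close>] y[OF \<open>m \<in> X\<close>] by simp
  finally show ?thesis
    using coercive[of "x - y"] by linarith
qed

text \<open>First variation: at a minimizer the derivative of the energy in every direction of the
  subspace vanishes.\<close>

lemma minimizer_solves:
  assumes X: "subspace X" "w \<in> X" "z \<in> X"
    and min: "\<And>z. z \<in> X \<Longrightarrow> energy f w \<le> energy f z"
  shows "b w z = f z"
proof -
  define c where "c = b w z - f z"
  have *: "0 \<le> 2 * t * c + t\<^sup>2 * b z z" for t
  proof -
    have "w + t *\<^sub>R z \<in> X"
      by (intro subspace_scale subspace_add X)
    from min[OF this] show ?thesis
      unfolding energy_def c_def square_add
      by (simp add: scaleR_left scaleR_right blinfun.bilinear_simps
          power2_eq_square algebra_simps)
  qed
  show ?thesis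
  proof (cases "b z z = 0")
    case True
    with *[of "- c"] have "c\<^sup>2 \<le> 0"
      by (simp add: power2_eq_square)
    then have "c = 0" by simp
    then show ?thesis by (simp add: c_def)
  next
    case False
    then have q: "b z z > 0" using nonneg[of z] by simp
    \<comment> \<open>this step length minimizes the quadratic polynomial in \<open>*\<close>\<close>
    have "0 \<le> 2 * (- c / b z z) * c + (- c / b z z)\<^sup>2 * b z z" by (rule *)
    also have "\<dots> = - (c\<^sup>2 / b z z)"
      using q by (simp add: power2_eq_square field_simps)
    finally have "c\<^sup>2 / b z z \<le> 0" by simp
    then have "c\<^sup>2 \<le> 0"
      using q by (simp add: divide_le_0_iff)
    then have "c = 0" by simp
    then show ?thesis by (simp add: c_def)
  qed
qed

lemma solution_bound:
  fixes f :: "'h \<Rightarrow>\<^sub>L real"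
  assumes "b w w = f w"
  shows "norm w \<le> norm f / \<alpha>"
proof (cases "w = 0")
  case True
  then show ?thesis using pos by simp
next
  case False
  have "\<alpha> * (norm w)\<^sup>2 \<le> norm f * norm w"
    using coercive[of w] norm_blinfun[of f w] assms by simp
  then have "\<alpha> * norm w \<le> norm f"
    using False by (simp add: power2_eq_square)
  then show ?thesis
    using pos by (simp add: field_simps)
qed

text \<open>Pythagoras in the inner product \<open>b\<close>: the error \<open>v - w\<close> is \<open>b\<close>-orthogonal to \<open>w - z\<close>.\<close>

lemma solution_is_best_approximation:
  assumes X: "subspace X" "w \<in> X" "z \<in> X"
    and orth: "\<And>z. z \<in> X \<Longrightarrow> b w z = b v z"
  shows "b (v - w) (v - w) \<le> b (v - z) (v - z)"
proof -
  have "w - z \<in> X"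
    using X by (simp add: subspace_diff)
  then have "b (v - w) (w - z) = 0"
    using orth[of "w - z"] by (simp add: diff_left)
  then have "b (v - z) (v - z) = b (v - w) (v - w) + b (w - z) (w - z)"
    using square_add[of "v - w" "w - z"] by simp
  then show ?thesis
    using nonneg[of "w - z"] by simp
qed

text \<open>Almost minimizers are close to each other by \<open>dist_almost_minimizers\<close>, so completeness gives a
  limit, which is a minimizer by continuity of the energy.\<close>

lemma minimizing_sequence_converges:
  fixes x :: "nat \<Rightarrow> 'h"
  assumes X: "subspace X" "closed X" "\<And>n. x n \<in> X"
    and x: "\<And>n z. z \<in> X \<Longrightarrow> energy f (x n) \<le> energy f z + inverse (real (Suc n))"
  obtains w where "w \<in> X" "x \<longlonglongrightarrow> w" "\<And>z. z \<in> X \<Longrightarrow> b w z = f z"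
proof -
  have "Cauchy x"
  proof (rule metric_CauchyI)
    fix e :: real assume "e > 0"
    then have "\<alpha> * e\<^sup>2 / 4 > 0" using pos by simp
    then obtain N where N: "inverse (real (Suc N)) < \<alpha> * e\<^sup>2 / 4"
      using reals_Archimedean by blast
    have "dist (x m) (x n) < e" if "m \<ge> N" "n \<ge> N" for m n
    proof -
      have le: "inverse (real (Suc j)) < \<alpha> * e\<^sup>2 / 4" if "j \<ge> N" for j
        using that le_imp_inverse_le[of "real (Suc N)" "real (Suc j)"]
        by (intro le_less_trans[OF _ N]) simp
      have "\<alpha> * (norm (x m - x n))\<^sup>2 \<le> 2 * (inverse (real (Suc m)) + inverse (real (Suc n)))"
        by (rule dist_almost_minimizers[OF X(1) X(3) X(3) x x])
      also have "\<dots> < \<alpha> * e\<^sup>2"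
        using le[OF that(1)] le[OF that(2)] by simp
      finally have "(norm (x m - x n))\<^sup>2 < e\<^sup>2"
        using pos by simp
      then show ?thesis
        using \<open>e > 0\<close> by (simp add: dist_norm power2_less_imp_less)
    qed
    then show "\<exists>M. \<forall>m\<ge>M. \<forall>n\<ge>M. dist (x m) (x n) < e" by blast
  qed
  then obtain w where w: "x \<longlonglongrightarrow> w"
    using Cauchy_convergent by (auto simp: convergent_def)
  then have "w \<in> X"
    using X closed_sequentially by blast
  have "energy f w \<le> energy f z" if "z \<in> X" for z
  proof (rule LIMSEQ_le)
    show "(\<lambda>n. energy f (x n)) \<longlonglongrightarrow> energy f w"
      using continuous_on_tendsto_compose[OF continuous_on_energy[of UNIV] w] by simp
    show "(\<lambda>n. energy f z + inverse (real (Suc n))) \<longlonglongrightarrow> energy f z"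
      using tendsto_add[OF tendsto_const LIMSEQ_inverse_real_of_nat] by simp
    show "\<exists>N. \<forall>n\<ge>N. energy f (x n) \<le> energy f z + inverse (real (Suc n))"
      using x that by blast
  qed
  with that w \<open>w \<in> X\<close> X(1) show ?thesis
    using minimizer_solves by blast
qed

lemma almost_minimizer_exists:
  assumes "X \<noteq> {}" "e > 0"
  obtains x where "x \<in> X" "\<And>z. z \<in> X \<Longrightarrow> energy f x < energy f z + e"
proof -
  have bdd: "bdd_below (energy f ` X)"
    using energy_bounded_below by (meson bdd_belowI2)
  have "Inf (energy f ` X) < Inf (energy f ` X) + e"
    using assms by simp
  then obtain x where "x \<in> X" "energy f x < Inf (energy f ` X) + e"
    using cInf_lessD[of "energy f ` X"] assms(1) by blast
  moreover have "Inf (energy f ` X) \<le> energy f z" if "z \<in> X" for z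
    using that bdd by (simp add: cINF_lower)
  ultimately show ?thesis
    using that by fastforce
qed

end

section \<open>Weak convergence in a separable Hilbert space\<close>

text \<open>The variational problem for the inner product itself.\<close>

lemma riesz_representation:
  fixes \<phi> :: "'h::{real_inner, complete_space} \<Rightarrow>\<^sub>L real"
  obtains v where "\<And>z. \<phi> z = v \<bullet> z"
proof -
  interpret coercive_symmetric_form "(\<bullet>) :: 'h \<Rightarrow> 'h \<Rightarrow> real" 1
    by (intro coercive_symmetric_form.intro coercive_symmetric_form_axioms.intro)
      (auto simp: bounded_bilinear_inner power2_norm_eq_inner inner_commute)
  have "\<forall>n. \<exists>x. \<forall>z. energy \<phi> x < energy \<phi> z + inverse (real (Suc n))"
    using almost_minimizer_exists[of UNIV _ \<phi>] by (metis UNIV_I UNIV_not_empty positive_imp_inverse_positive of_nat_0_less_iff zero_less_Suc)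
  then obtain x where "\<And>n z. energy \<phi> (x n) < energy \<phi> z + inverse (real (Suc n))"
    by metis
  then obtain v where "\<And>z. v \<bullet> z = \<phi> z"
    using minimizing_sequence_converges[of UNIV x \<phi>] 
    by (metis UNIV_I closed_UNIV less_imp_le subspace_UNIV)
  then show ?thesis using that by metis
qed

definition weakly_converges :: "(nat \<Rightarrow> 'h::real_normed_vector) \<Rightarrow> 'h \<Rightarrow> bool" where
  "weakly_converges x l \<longleftrightarrow> (\<forall>\<phi> :: 'h \<Rightarrow>\<^sub>L real. (\<lambda>n. \<phi> (x n)) \<longlonglongrightarrow> \<phi> l)"

lemma weakly_converges_subseq:
  assumes "weakly_converges x l" "strict_mono r"
  shows "weakly_converges (\<lambda>n. x (r n)) l"
  using assms LIMSEQ_subseq_LIMSEQ[OF _ assms(2)]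
  unfolding weakly_converges_def comp_def by blast

lemma weakly_converges_sum:
  assumes "\<And>i. i \<in> I \<Longrightarrow> (\<lambda>n. c n i) \<longlonglongrightarrow> d i"
    and "\<And>i. i \<in> I \<Longrightarrow> weakly_converges (\<lambda>n. e n i) (l i)"
  shows "weakly_converges (\<lambda>n. \<Sum>i\<in>I. c n i *\<^sub>R e n i) (\<Sum>i\<in>I. d i *\<^sub>R l i)"
  unfolding weakly_converges_def blinfun.sum_right blinfun.scaleR_right real_scaleR_def
  using assms unfolding weakly_converges_def
  by (intro allI tendsto_sum tendsto_mult) auto

text \<open>Convexity makes the quadratic form weakly lower semicontinuous: it lies above its tangent
  at the limit, and the tangent is weakly continuous.\<close>

lemma (in coercive_symmetric_form) weakly_lower_semicontinuous:
  assumes x: "weakly_converges x l" and le: "\<And>n. b (v - x n) (v - x n) \<le> q"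
  shows "b (v - l) (v - l) \<le> q"
proof -
  define \<phi> where "\<phi> = Blinfun (b (v - l))"
  have \<phi>: "\<phi> z = b (v - l) z" for z
    unfolding \<phi>_def by (simp add: bounded_linear_Blinfun_apply bounded_linear_right)
  have "(\<lambda>n. \<phi> (x n)) \<longlonglongrightarrow> \<phi> l"
    using x unfolding weakly_converges_def by blast
  then have "(\<lambda>n. 2 * (\<phi> v - \<phi> (x n)) - b (v - l) (v - l))
      \<longlonglongrightarrow> 2 * (\<phi> v - \<phi> l) - b (v - l) (v - l)"
    by (intro tendsto_diff tendsto_mult tendsto_const)
  moreover have "2 * (\<phi> v - \<phi> (x n)) - b (v - l) (v - l) \<le> q" for n
  proof -
    have "0 \<le> b ((v - l) - (v - x n)) ((v - l) - (v - x n))" by (rule nonneg)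
    also have "\<dots> = b (v - l) (v - l) - 2 * (\<phi> v - \<phi> (x n)) + b (v - x n) (v - x n)"
      unfolding square_diff[of "v - l"] \<phi> by (simp add: diff_right)
    finally show ?thesis using le[of n] by linarith
  qed
  ultimately have "2 * (\<phi> v - \<phi> l) - b (v - l) (v - l) \<le> q"
    by (intro LIMSEQ_le_const2) auto
  then show ?thesis
    by (simp add: \<phi> flip: diff_right)
qed

text \<open>On a bounded sequence, convergence of the inner products extends from a dense set to all
  vectors by equicontinuity; the limit is a bounded functional, and its Riesz vector is the weak
  limit.\<close>

lemma dense_inner_convergence_imp_weakly_converges:
  fixes x :: "nat \<Rightarrow> 'h::{real_inner, complete_space}"
  assumes bound: "\<And>n. norm (x n) \<le> 1"
    and dense: "closure D = UNIV"
    and conv: "\<And>d. d \<in> D \<Longrightarrow> convergent (\<lambda>n. x n \<bullet> d)"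
  shows "\<exists>l. weakly_converges x l"
proof -
  have close: "\<bar>x n \<bullet> z - x n \<bullet> d\<bar> \<le> norm (z - d)" for n z d
  proof -
    have "\<bar>x n \<bullet> (z - d)\<bar> \<le> norm (x n) * norm (z - d)"
      by (rule Cauchy_Schwarz_ineq2)
    also have "\<dots> \<le> 1 * norm (z - d)"
      using bound by (intro mult_right_mono) auto
    finally show ?thesis by (simp add: inner_diff_right)
  qed
  have conv_all: "convergent (\<lambda>n. x n \<bullet> z)" for z
  proof (rule Cauchy_convergent, rule metric_CauchyI)
    fix e :: real assume "e > 0"
    obtain d where d: "d \<in> D" "dist d z < e / 3"
      using dense \<open>e > 0\<close> closure_approachable[of z D] by (metis UNIV_I divide_pos_pos zero_less_numeral)
    then have "Cauchy (\<lambda>n. x n \<bullet> d)"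
      using conv by (simp add: Cauchy_convergent_iff)
    then obtain N where N: "\<And>m n. m \<ge> N \<Longrightarrow> n \<ge> N \<Longrightarrow> dist (x m \<bullet> d) (x n \<bullet> d) < e / 3"
      using \<open>e > 0\<close> metric_CauchyD[of "\<lambda>n. x n \<bullet> d" "e / 3"] by auto
    have "dist (x m \<bullet> z) (x n \<bullet> z) < e" if "m \<ge> N" "n \<ge> N" for m n
      using N[OF that] close[of m z d] close[of n z d] d(2)
      unfolding dist_real_def by (simp add: dist_norm norm_minus_commute abs_if split: if_splits)
    then show "\<exists>M. \<forall>m\<ge>M. \<forall>n\<ge>M. dist (x m \<bullet> z) (x n \<bullet> z) < e" by blast
  qed
  define L where "L z = lim (\<lambda>n. x n \<bullet> z)" for z
  have L: "(\<lambda>n. x n \<bullet> z) \<longlonglongrightarrow> L z" for z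
    using conv_all[of z] unfolding L_def by (simp add: convergent_LIMSEQ_iff)
  have "bounded_linear L"
  proof (rule bounded_linear_intro[where K = 1])
    show "L (y + z) = L y + L z" for y z
      using tendsto_add[OF L[of y] L[of z]] L[of "y + z"]
      by (auto simp: inner_add_right intro: LIMSEQ_unique)
    show "L (r *\<^sub>R z) = r *\<^sub>R L z" for r z
      using tendsto_mult[OF tendsto_const[of r] L[of z]] L[of "r *\<^sub>R z"]
      by (auto intro: LIMSEQ_unique)
    show "norm (L z) \<le> norm z * 1" for z
    proof (rule LIMSEQ_le_const2[OF tendsto_norm[OF L]])
      show "\<exists>N. \<forall>n\<ge>N. norm (x n \<bullet> z) \<le> norm z * 1"
        using close[of _ z 0] by simp
    qed
  qed
  then obtain l where l: "\<And>z. L z = l \<bullet> z"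
    using riesz_representation[of "Blinfun L"] by (metis bounded_linear_Blinfun_apply)
  have "weakly_converges x l"
    unfolding weakly_converges_def
  proof
    fix \<phi> :: "'h \<Rightarrow>\<^sub>L real"
    obtain v where "\<And>z. \<phi> z = v \<bullet> z"
      using riesz_representation by blast
    then show "(\<lambda>n. \<phi> (x n)) \<longlonglongrightarrow> \<phi> l"
      using L[of v] l[of v] by (simp add: inner_commute)
  qed
  then show ?thesis by blast
qed

text \<open>Sequential weak compactness of the unit ball, for countably many sequences along a common
  subsequence: a diagonal argument over all pairs of a sequence and a vector of a countable
  dense set.\<close>

lemma weakly_convergent_subsequence:
  fixes e :: "nat \<Rightarrow> 'i \<Rightarrow> 'h::{real_inner, complete_space, second_countable_topology}"
  assumes I: "countable I" and bound: "\<And>n i. norm (e n i) \<le> 1"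
  obtains r l where "strict_mono (r :: nat \<Rightarrow> nat)"
    "\<And>i. i \<in> I \<Longrightarrow> weakly_converges (\<lambda>n. e (r n) i) (l i)"
proof -
  obtain D :: "'h set" where D: "countable D" "closure D = UNIV"
    using separable[of "UNIV :: 'h set"] by (metis top.extremum_uniqueI)
  \<comment> \<open>the test vectors are scaled into the unit ball because the diagonal argument asks for a bound
    uniform in the test vector\<close>
  define g where "g n p = e n (fst p) \<bullet> (inverse (1 + norm (snd p)) *\<^sub>R snd p)"
    for n and p :: "'i \<times> 'h"
  have "norm (g n p) \<le> 1" for n p
  proof -
    have "norm (g n p) \<le> norm (e n (fst p)) * norm (inverse (1 + norm (snd p)) *\<^sub>R snd p)"
      unfolding g_def real_norm_def by (rule Cauchy_Schwarz_ineq2)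
    also have "\<dots> \<le> 1 * 1"
    proof (intro mult_mono)
      have "0 < 1 + norm (snd p)"
        by (simp add: add_pos_nonneg)
      then show "norm (inverse (1 + norm (snd p)) *\<^sub>R snd p) \<le> 1"
        by (simp add: field_simps)
    qed (use bound in auto)
    finally show ?thesis by simp
  qed
  moreover have "countable (I \<times> D)"
    using I D(1) by simp
  ultimately obtain r where r: "strict_mono (r :: nat \<Rightarrow> nat)"
    and conv: "\<And>p. p \<in> I \<times> D \<Longrightarrow> \<exists>l. (\<lambda>n. g (r n) p) \<longlonglongrightarrow> l"
    using function_convergent_subsequence[of "I \<times> D" g 1] by blast
  have "\<exists>l. weakly_converges (\<lambda>n. e (r n) i) l" if i: "i \<in> I" for i
  proof (rule dense_inner_convergence_imp_weakly_converges[OF bound D(2)])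
    fix d assume "d \<in> D"
    then obtain l where "(\<lambda>n. g (r n) (i, d)) \<longlonglongrightarrow> l"
      using conv[of "(i, d)"] i by blast
    then have "(\<lambda>n. (1 + norm d) * g (r n) (i, d)) \<longlonglongrightarrow> (1 + norm d) * l"
      by (intro tendsto_intros)
    moreover have "(1 + norm d) * g n (i, d) = e n i \<bullet> d" for n
    proof -
      have "1 + norm d \<noteq> 0"
        using norm_ge_zero[of d] by linarith
      then show ?thesis unfolding g_def by simp
    qed
    ultimately show "convergent (\<lambda>n. e (r n) i \<bullet> d)"
      by (auto simp: convergent_def)
  qed
  with r that show ?thesis by metis
qed

section \<open>Subspaces of dimension at most k\<close>

text \<open>The vectors \<open>e i\<close> are an orthonormal basis padded with zeros, so that every subspace of
  dimension at most \<open>k\<close> is described by exactly \<open>k\<close> vectors and the coefficients are controlled by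
  the norm of \<open>z\<close>.  Padding matters for passing to weak limits, as the dimension may vary along a
  sequence of subspaces.\<close>

lemma subspaces_dim_le_expansion:
  fixes Z :: "'h::real_inner set"
  assumes "Z \<in> subspaces_dim_le k"
  obtains e :: "nat \<Rightarrow> 'h" where "\<And>i. norm (e i) \<le> 1"
    "Z = {z. z = (\<Sum>i<k. (z \<bullet> e i) *\<^sub>R e i)}"
proof -
  obtain B where Z: "subspace Z" "finite B" "span B = Z" "dim Z \<le> k"
    using assms unfolding subspaces_dim_le_def by auto
  obtain A where A: "A \<subseteq> Z" "independent A" "Z \<subseteq> span A" "card A = dim Z"
    using basis_exists by blast
  have "finite A"
    using independent_span_bound[OF Z(2) A(2)] A(1) Z(3) by simp
  then obtain C where C: "finite C" "card C \<le> card A" "span C = span A" "pairwise orthogonal C"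
    using basis_orthogonal by blast
  have span: "span C = Z"
    using A Z(1) C(3) span_minimal by blast
  have card: "card C \<le> k"
    using C A Z by simp
  obtain g where g: "bij_betw g {..<card C} C"
    using ex_bij_betw_nat_finite[OF C(1)] by (auto simp: atLeast0LessThan)
  define e where "e i = (if i < card C then sgn (g i) else 0)" for i
  have norm: "norm (e i) \<le> 1" for i
    unfolding e_def by (simp add: norm_sgn)
  have gC: "g i \<in> C" if "i < card C" for i
    using g that by (auto simp: bij_betw_def)
  have eZ: "e i \<in> Z" for i
    unfolding e_def using gC span_base[of "g i" C] span Z(1)
    by (auto simp: sgn_div_norm subspace_0 intro!: subspace_scale)
  have proj: "g j = (\<Sum>i<k. (g j \<bullet> e i) *\<^sub>R e i)" if j: "j < card C" for j
  proof -
    have "(g j \<bullet> e i) *\<^sub>R e i = (if i = j then g j else 0)" for i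
    proof (cases "i < card C \<and> i \<noteq> j")
      case True
      then have "g i \<noteq> g j"
        using g j by (auto simp: bij_betw_def inj_on_def)
      then have "orthogonal (g j) (g i)"
        using C(4) gC True j by (auto simp: pairwise_def)
      then show ?thesis
        using True by (simp add: e_def sgn_div_norm orthogonal_def)
    next
      case False
      show ?thesis
      proof (cases "i = j \<and> g j \<noteq> 0")
        case True
        then have "(g j \<bullet> e i) *\<^sub>R e i = (inverse (norm (g j)) * (norm (g j))\<^sup>2 * inverse (norm (g j))) *\<^sub>R g j"
          using j by (simp add: e_def sgn_div_norm dot_square_norm)
        moreover have "inverse t * t\<^sup>2 * inverse t = 1" if "t \<noteq> 0" for t :: real
          using that by (simp add: power2_eq_square mult.assoc)
        from this[of "norm (g j)"] True
        have "inverse (norm (g j)) * (norm (g j))\<^sup>2 * inverse (norm (g j)) = 1"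
          by simp
        ultimately show ?thesis
          using True by simp
      next
        case ij: False
        then show ?thesis
          using False by (auto simp: e_def)
      qed
    qed
    then show ?thesis
      using j card by simp
  qed
  have "Z = {z. z = (\<Sum>i<k. (z \<bullet> e i) *\<^sub>R e i)}"
  proof (intro equalityI subsetI)
    fix z assume "z \<in> Z"
    have "subspace {z. z = (\<Sum>i<k. (z \<bullet> e i) *\<^sub>R e i)}"
      unfolding subspace_def mem_Collect_eq inner_add_left inner_scaleR_left
        scaleR_left_distrib sum.distrib scaleR_scaleR[symmetric] scaleR_sum_right[symmetric]
      by simp
    moreover have "C \<subseteq> {z. z = (\<Sum>i<k. (z \<bullet> e i) *\<^sub>R e i)}"
    proof
      fix c assume "c \<in> C"
      then obtain j where "j < card C" "c = g j"
        using g by (auto simp: bij_betw_def)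
      then show "c \<in> {z. z = (\<Sum>i<k. (z \<bullet> e i) *\<^sub>R e i)}"
        using proj by blast
    qed
    ultimately have "span C \<subseteq> {z. z = (\<Sum>i<k. (z \<bullet> e i) *\<^sub>R e i)}"
      by (simp add: span_minimal)
    then show "z \<in> {z. z = (\<Sum>i<k. (z \<bullet> e i) *\<^sub>R e i)}"
      using \<open>z \<in> Z\<close> span by blast
  next
    fix z assume "z \<in> {z. z = (\<Sum>i<k. (z \<bullet> e i) *\<^sub>R e i)}"
    moreover have "(\<Sum>i<k. (z \<bullet> e i) *\<^sub>R e i) \<in> Z"
      using eZ Z(1) by (intro subspace_sum subspace_scale)
    ultimately show "z \<in> Z" by simp
  qed
  with norm that show ?thesis by blast
qed

lemma closed_subspaces_dim_le:
  fixes Z :: "'h::real_inner set"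
  assumes "Z \<in> subspaces_dim_le k"
  shows "closed Z"
proof -
  obtain e :: "nat \<Rightarrow> 'h" where "Z = {z. z = (\<Sum>i<k. (z \<bullet> e i) *\<^sub>R e i)}"
    using subspaces_dim_le_expansion[OF assms] by metis
  then show ?thesis
    by (simp only:) (intro closed_Collect_eq continuous_intros)
qed

lemma span_in_subspaces_dim_le: "span (l ` {..<k}) \<in> subspaces_dim_le k"
proof -
  have "dim (span (l ` {..<k})) \<le> card (l ` {..<k})"
    by (simp add: dim_le_card')
  also have "\<dots> \<le> k"
    using card_image_le[of "{..<k}" l] by simp
  finally show ?thesis
    unfolding subspaces_dim_le_def by auto
qed

text \<open>The coefficients are inner products with vectors of the unit ball, so they are bounded by \<open>R\<close>
  and converge along a subsequence; a product of convergent coefficients and weakly convergent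
  vectors converges weakly.\<close>

lemma bounded_sequence_in_moving_subspaces:
  fixes e :: "nat \<Rightarrow> nat \<Rightarrow> 'h::real_inner"
  assumes e: "\<And>n i. norm (e n i) \<le> 1"
    and l: "\<And>i. i < k \<Longrightarrow> weakly_converges (\<lambda>n. e n i) (l i)"
    and z: "\<And>n. z n = (\<Sum>i<k. (z n \<bullet> e n i) *\<^sub>R e n i)"
    and bound: "\<And>n. norm (z n) \<le> R"
  obtains r w where "strict_mono (r :: nat \<Rightarrow> nat)" "w \<in> span (l ` {..<k})"
    "weakly_converges (\<lambda>n. z (r n)) w"
proof -
  have "norm (z n \<bullet> e n i) \<le> R" for n i
  proof -
    have "norm (z n \<bullet> e n i) \<le> norm (z n) * norm (e n i)"
      unfolding real_norm_def by (rule Cauchy_Schwarz_ineq2)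
    also have "\<dots> \<le> norm (z n) * 1"
      using e by (intro mult_left_mono) auto
    finally show ?thesis using bound[of n] by simp
  qed
  then obtain r where r: "strict_mono (r :: nat \<Rightarrow> nat)"
    and "\<And>i. i \<in> {..<k} \<Longrightarrow> \<exists>d. (\<lambda>n. z (r n) \<bullet> e (r n) i) \<longlonglongrightarrow> d"
    using function_convergent_subsequence[of "{..<k}" "\<lambda>n i. z n \<bullet> e n i" R]
      countable_finite[OF finite_lessThan] by blast
  then obtain d where d: "\<And>i. i \<in> {..<k} \<Longrightarrow> (\<lambda>n. z (r n) \<bullet> e (r n) i) \<longlonglongrightarrow> d i"
    by metis
  have "weakly_converges (\<lambda>n. \<Sum>i<k. (z (r n) \<bullet> e (r n) i) *\<^sub>R e (r n) i) (\<Sum>i<k. d i *\<^sub>R l i)"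
    using d l weakly_converges_subseq[OF _ r] by (intro weakly_converges_sum) auto
  then have "weakly_converges (\<lambda>n. z (r n)) (\<Sum>i<k. d i *\<^sub>R l i)"
    using z by simp
  moreover have "(\<Sum>i<k. d i *\<^sub>R l i) \<in> span (l ` {..<k})"
    by (intro span_sum span_scale span_base) auto
  ultimately show ?thesis
    using that r by blast
qed

text \<open>Given any number above the lower limit, pass to a subsequence whose errors stay below it.  By
  coercivity the approximations are then bounded, so they have a weak limit point in the limit
  space.  By lower semicontinuity its error is below that number too, and the error of \<open>w\<close> is no
  larger.\<close>

lemma (in coercive_symmetric_form) best_approximation_error_le_liminf:
  fixes e :: "nat \<Rightarrow> nat \<Rightarrow> 'h"
  assumes e: "\<And>n i. norm (e n i) \<le> 1"
    and l: "\<And>i. i < k \<Longrightarrow> weakly_converges (\<lambda>n. e n i) (l i)"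
    and z: "\<And>n. z n = (\<Sum>i<k. (z n \<bullet> e n i) *\<^sub>R e n i)"
    and w: "w \<in> span (l ` {..<k})" "\<And>x. x \<in> span (l ` {..<k}) \<Longrightarrow> b w x = b v x"
  shows "ennreal (b (v - w) (v - w)) \<le> liminf (\<lambda>n. ennreal (b (v - z n) (v - z n)))"
proof (rule ccontr)
  let ?g = "\<lambda>n. ennreal (b (v - z n) (v - z n))"
  assume "\<not> ?thesis"
  then obtain q where q: "liminf ?g < q" "q < ennreal (b (v - w) (v - w))"
    using dense by (auto simp: not_le)
  then obtain t where t: "q = ennreal t" "t \<ge> 0"
    by (cases q) auto
  have "infinite {n. ?g n < q}"
  proof
    assume "finite {n. ?g n < q}"
    then have "eventually (\<lambda>n. q \<le> ?g n) sequentially"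
      by (simp add: eventually_cofinite not_le flip: cofinite_eq_sequentially)
    then have "q \<le> liminf ?g"
      by (rule Liminf_bounded)
    with q show False by simp
  qed
  then obtain r where r: "strict_mono (r :: nat \<Rightarrow> nat)" "\<And>n. ?g (r n) < q"
    using infinite_enumerate[of "{n. ?g n < q}"] by auto
  have le: "b (v - z (r n)) (v - z (r n)) \<le> t" for n
    using r(2)[of n] t nonneg by (simp add: ennreal_less_iff)
  have bound: "norm (z (r n)) \<le> norm v + sqrt (t / \<alpha>)" for n
  proof -
    have "(norm (v - z (r n)))\<^sup>2 \<le> t / \<alpha>"
      using le[of n] coercive[of "v - z (r n)"] pos by (simp add: field_simps)
    then have "norm (v - z (r n)) \<le> sqrt (t / \<alpha>)"
      by (rule real_le_rsqrt)
    then show ?thesis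
      using norm_triangle_ineq2[of "z (r n)" v] by (simp add: norm_minus_commute)
  qed
  have l': "\<And>i. i < k \<Longrightarrow> weakly_converges (\<lambda>n. e (r n) i) (l i)"
    using l weakly_converges_subseq[OF _ r(1)] by blast
  obtain r' w' where w': "w' \<in> span (l ` {..<k})" "weakly_converges (\<lambda>n. z (r (r' n))) w'"
    using bounded_sequence_in_moving_subspaces[of "\<lambda>n. e (r n)" k l "\<lambda>n. z (r n)", OF e l' z bound]
    by blast
  have "b (v - w) (v - w) \<le> b (v - w') (v - w')"
    using w w'(1) by (intro solution_is_best_approximation[of "span (l ` {..<k})"]) auto
  also have "\<dots> \<le> t"
    using weakly_lower_semicontinuous[OF w'(2)] le by blast
  finally show False
    using q(2) t by (simp add: ennreal_less_iff)
qed

section \<open>Square integrable fields of vectors and functionals\<close>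

lemma strongly_measurable_imp_borel_measurable:
  assumes "strongly_measurable M f"
  shows "f \<in> borel_measurable M"
proof -
  obtain s where s: "\<forall>n::nat. simple_function M (s n)" "\<forall>\<gamma>\<in>space M. (\<lambda>n. s n \<gamma>) \<longlonglongrightarrow> f \<gamma>"
    using assms unfolding strongly_measurable_def by blast
  show ?thesis
    by (rule borel_measurable_LIMSEQ_metric[of s])
      (use s in \<open>auto intro: borel_measurable_simple_function\<close>)
qed

lemma borel_measurable_imp_strongly_measurable:
  fixes f :: "'g \<Rightarrow> 'b::{metric_space, second_countable_topology}"
  assumes "f \<in> borel_measurable M"
  shows "strongly_measurable M f"
  using borel_measurable_implies_sequence_metric[OF assms, of undefined]
  unfolding strongly_measurable_def by blast

lemma strongly_measurable_binary:
  assumes f: "strongly_measurable M f" and g: "strongly_measurable M g"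
    and op: "\<And>x y s t. s \<longlonglongrightarrow> x \<Longrightarrow> t \<longlonglongrightarrow> y \<Longrightarrow> (\<lambda>n. op (s n) (t n)) \<longlonglongrightarrow> op x y"
  shows "strongly_measurable M (\<lambda>\<gamma>. op (f \<gamma>) (g \<gamma>))"
proof -
  obtain s t where s: "\<forall>n::nat. simple_function M (s n)" "\<forall>\<gamma>\<in>space M. (\<lambda>n. s n \<gamma>) \<longlonglongrightarrow> f \<gamma>"
    and t: "\<forall>n::nat. simple_function M (t n)" "\<forall>\<gamma>\<in>space M. (\<lambda>n. t n \<gamma>) \<longlonglongrightarrow> g \<gamma>"
    using f g unfolding strongly_measurable_def by blast
  show ?thesis
    unfolding strongly_measurable_def
    using s t op
    by (intro exI[of _ "\<lambda>n \<gamma>. op (s n \<gamma>) (t n \<gamma>)"]) (auto intro: simple_function_compose2)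
qed

lemma strongly_measurable_blinfun_apply:
  "strongly_measurable M f \<Longrightarrow> strongly_measurable M v \<Longrightarrow>
    strongly_measurable M (\<lambda>\<gamma>. blinfun_apply (f \<gamma>) (v \<gamma>))"
  by (rule strongly_measurable_binary) (auto intro: blinfun.tendsto)

lemma borel_measurable_blinfun_apply:
  "strongly_measurable M f \<Longrightarrow> strongly_measurable M v \<Longrightarrow>
    (\<lambda>\<gamma>. blinfun_apply (f \<gamma>) (v \<gamma>)) \<in> borel_measurable M"
  by (intro strongly_measurable_imp_borel_measurable strongly_measurable_blinfun_apply)

lemma strongly_measurable_const: "strongly_measurable M (\<lambda>_. c)"
  unfolding strongly_measurable_def by (intro exI[of _ "\<lambda>_ _. c"]) auto

lemma borel_measurable_norm_strongly_measurable:
  assumes "strongly_measurable M (v :: 'g \<Rightarrow> 'b::real_normed_vector)"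
  shows "(\<lambda>\<gamma>. norm (v \<gamma>)) \<in> borel_measurable M"
  using measurable_compose[OF strongly_measurable_imp_borel_measurable[OF assms]]
    borel_measurable_continuous_onI[of norm] continuous_on_norm_id by blast

lemma bochner_L2_mono: "v \<in> bochner_L2 M X \<Longrightarrow> X \<subseteq> Y \<Longrightarrow> v \<in> bochner_L2 M Y"
  unfolding bochner_L2_def by auto

text \<open>Domination; \<open>f\<close> may take values in another space than \<open>v\<close>, for instance in the dual.\<close>

lemma bochner_L2_boundI:
  assumes v: "strongly_measurable M v" "AE \<gamma> in M. v \<gamma> \<in> X"
    and f: "integrable M (\<lambda>\<gamma>. (norm (f \<gamma>))\<^sup>2)"
    and le: "AE \<gamma> in M. norm (v \<gamma>) \<le> C * norm (f \<gamma>)"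
  shows "v \<in> bochner_L2 M X"
proof -
  have "integrable M (\<lambda>\<gamma>. (norm (v \<gamma>))\<^sup>2)"
  proof (rule Bochner_Integration.integrable_bound)
    show "integrable M (\<lambda>\<gamma>. C\<^sup>2 * (norm (f \<gamma>))\<^sup>2)"
      using f by simp
    show "(\<lambda>\<gamma>. (norm (v \<gamma>))\<^sup>2) \<in> borel_measurable M"
      using borel_measurable_norm_strongly_measurable[OF v(1)] by simp
    show "AE \<gamma> in M. norm ((norm (v \<gamma>))\<^sup>2) \<le> norm (C\<^sup>2 * (norm (f \<gamma>))\<^sup>2)"
      using le
    proof eventually_elim
      case (elim \<gamma>)
      then have "(norm (v \<gamma>))\<^sup>2 \<le> (C * norm (f \<gamma>))\<^sup>2"
        by (intro power_mono) auto
      then show ?case by (simp add: power_mult_distrib)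
    qed
  qed
  with v show ?thesis unfolding bochner_L2_def by blast
qed

lemma bochner_L2_diff:
  fixes v w :: "'g \<Rightarrow> 'b::real_normed_vector"
  assumes X: "subspace X" and v: "v \<in> bochner_L2 M X" and w: "w \<in> bochner_L2 M X"
  shows "(\<lambda>\<gamma>. v \<gamma> - w \<gamma>) \<in> bochner_L2 M X"
proof -
  have meas: "strongly_measurable M (\<lambda>\<gamma>. v \<gamma> - w \<gamma>)"
    using v w unfolding bochner_L2_def
    by (intro strongly_measurable_binary[of M v w "(-)"]) (auto intro: tendsto_diff)
  have "AE \<gamma> in M. v \<gamma> \<in> X" "AE \<gamma> in M. w \<gamma> \<in> X"
    using v w unfolding bochner_L2_def by auto
  then have X: "AE \<gamma> in M. v \<gamma> - w \<gamma> \<in> X"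
    by eventually_elim (rule subspace_diff[OF X])
  have "integrable M (\<lambda>\<gamma>. (norm (v \<gamma> - w \<gamma>))\<^sup>2)"
  proof (rule Bochner_Integration.integrable_bound)
    show "integrable M (\<lambda>\<gamma>. 2 * (norm (v \<gamma>))\<^sup>2 + 2 * (norm (w \<gamma>))\<^sup>2)"
      using v w unfolding bochner_L2_def by auto
    show "(\<lambda>\<gamma>. (norm (v \<gamma> - w \<gamma>))\<^sup>2) \<in> borel_measurable M"
      using borel_measurable_norm_strongly_measurable[OF meas] by simp
    have "(norm (x - y))\<^sup>2 \<le> 2 * (norm x)\<^sup>2 + 2 * (norm y)\<^sup>2" for x y :: 'b
    proof -
      have "(norm (x - y))\<^sup>2 \<le> (norm x + norm y)\<^sup>2"
        by (intro power_mono norm_triangle_ineq4) auto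
      also have "\<dots> \<le> 2 * (norm x)\<^sup>2 + 2 * (norm y)\<^sup>2"
        using sum_squares_bound[of "norm x" "norm y"] by (simp add: power2_sum)
      finally show ?thesis .
    qed
    then show "AE \<gamma> in M. norm ((norm (v \<gamma> - w \<gamma>))\<^sup>2)
        \<le> norm (2 * (norm (v \<gamma>))\<^sup>2 + 2 * (norm (w \<gamma>))\<^sup>2)"
      by auto
  qed
  with meas X show ?thesis unfolding bochner_L2_def by blast
qed

lemma integrable_duality_pairing:
  fixes f :: "'g \<Rightarrow> 'h::real_normed_vector \<Rightarrow>\<^sub>L real"
  assumes f: "f \<in> bochner_L2 M UNIV" and v: "v \<in> bochner_L2 M X"
  shows "integrable M (\<lambda>\<gamma>. f \<gamma> (v \<gamma>))"
proof (rule Bochner_Integration.integrable_bound)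
  show "integrable M (\<lambda>\<gamma>. (norm (f \<gamma>))\<^sup>2 + (norm (v \<gamma>))\<^sup>2)"
    using f v unfolding bochner_L2_def by auto
  show "(\<lambda>\<gamma>. f \<gamma> (v \<gamma>)) \<in> borel_measurable M"
    using f v unfolding bochner_L2_def by (auto intro: borel_measurable_blinfun_apply)
  have "\<bar>f \<gamma> (v \<gamma>)\<bar> \<le> (norm (f \<gamma>))\<^sup>2 + (norm (v \<gamma>))\<^sup>2" for \<gamma>
  proof -
    have "\<bar>f \<gamma> (v \<gamma>)\<bar> \<le> norm (f \<gamma>) * norm (v \<gamma>)"
      using norm_blinfun[of "f \<gamma>" "v \<gamma>"] by simp
    also have "\<dots> \<le> 2 * norm (f \<gamma>) * norm (v \<gamma>)"
      by simp
    also have "\<dots> \<le> (norm (f \<gamma>))\<^sup>2 + (norm (v \<gamma>))\<^sup>2"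
      by (rule sum_squares_bound)
    finally show ?thesis .
  qed
  then show "AE \<gamma> in M. norm (f \<gamma> (v \<gamma>)) \<le> norm ((norm (f \<gamma>))\<^sup>2 + (norm (v \<gamma>))\<^sup>2)"
    by auto
qed

section \<open>Fields of coercive forms and their Galerkin solutions\<close>

locale coercive_form_field =
  fixes M :: "'g measure"
    and a :: "'g \<Rightarrow> 'h::{real_inner, complete_space, second_countable_topology} \<Rightarrow>\<^sub>L 'h \<Rightarrow>\<^sub>L real"
    and \<alpha> :: real
  assumes a: "a \<in> bochner_Linf M sym_bilinear_forms"
    and \<alpha>: "\<alpha> > 0"
    and coercive: "AE \<gamma> in M. \<forall>v. \<alpha> * (norm v)\<^sup>2 \<le> a \<gamma> v v"
begin

lemma AE_coercive_symmetric_form: "AE \<gamma> in M. coercive_symmetric_form (\<lambda>v w. a \<gamma> v w) \<alpha>"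
proof -
  have "AE \<gamma> in M. a \<gamma> \<in> sym_bilinear_forms"
    using a unfolding bochner_Linf_def by blast
  with coercive show ?thesis
  proof eventually_elim
    case (elim \<gamma>)
    have "bounded_bilinear (\<lambda>v w. a \<gamma> v w)"
      using bounded_bilinear.comp1[OF bounded_bilinear_blinfun_apply blinfun.bounded_linear_right] .
    with elim \<alpha> show ?case
      unfolding coercive_symmetric_form_def coercive_symmetric_form_axioms_def
        sym_bilinear_forms_def by simp
  qed
qed

text \<open>This turns the form into a right-hand side, so that best approximation of \<open>v\<close> in a subspace
  becomes a Galerkin problem.\<close>

lemma form_apply_L2:
  assumes v: "v \<in> bochner_L2 M X"
  shows "(\<lambda>\<gamma>. a \<gamma> (v \<gamma>)) \<in> bochner_L2 M UNIV"
proof -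
  obtain C where C: "AE \<gamma> in M. norm (a \<gamma>) \<le> C"
    using a unfolding bochner_Linf_def by blast
  show ?thesis
  proof (rule bochner_L2_boundI)
    show "strongly_measurable M (\<lambda>\<gamma>. a \<gamma> (v \<gamma>))"
      using a v unfolding bochner_Linf_def bochner_L2_def
      by (auto intro: strongly_measurable_blinfun_apply)
    show "integrable M (\<lambda>\<gamma>. (norm (v \<gamma>))\<^sup>2)"
      using v unfolding bochner_L2_def by blast
    show "AE \<gamma> in M. norm (a \<gamma> (v \<gamma>)) \<le> C * norm (v \<gamma>)"
      using C
    proof eventually_elim
      case (elim \<gamma>)
      have "norm (a \<gamma> (v \<gamma>)) \<le> norm (a \<gamma>) * norm (v \<gamma>)"
        by (rule norm_blinfun)
      also have "\<dots> \<le> C * norm (v \<gamma>)"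
        using elim by (intro mult_right_mono) auto
      finally show ?case .
    qed
  qed simp
qed

lemma integrable_form:
  "v \<in> bochner_L2 M X \<Longrightarrow> w \<in> bochner_L2 M Y \<Longrightarrow> integrable M (\<lambda>\<gamma>. a \<gamma> (v \<gamma>) (w \<gamma>))"
  using integrable_duality_pairing[OF form_apply_L2] .

lemma AE_form_nonneg: "AE \<gamma> in M. \<forall>v. 0 \<le> a \<gamma> v v"
  using AE_coercive_symmetric_form by eventually_elim (auto dest: coercive_symmetric_form.nonneg)

lemma abar_nonneg: "0 \<le> abar M a v v"
  unfolding abar_def using AE_form_nonneg by (intro integral_nonneg_AE) auto

text \<open>Lax-Milgram at each parameter, with measurable dependence on it.  The energy of a fixed vector
  is measurable in \<open>\<gamma>\<close>, hence so is the index of the first vector in a countable dense sequence that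
  is an almost minimizer among the members of that sequence.  By density it is an almost minimizer
  on all of \<open>X\<close>.  On the null set where the form may fail to be coercive, all fields are set to 0,
  so that convergence, and with it measurability of the limit, holds everywhere.\<close>

lemma pointwise_solution_exists:
  fixes f :: "'g \<Rightarrow> 'h \<Rightarrow>\<^sub>L real"
  assumes X: "subspace X" "closed X" and f: "f \<in> bochner_L2 M UNIV"
  obtains w where "w \<in> bochner_L2 M X" "AE \<gamma> in M. \<forall>z\<in>X. a \<gamma> (w \<gamma>) z = f \<gamma> z"
proof -
  define J where "J \<gamma> z = a \<gamma> z z - 2 * f \<gamma> z" for \<gamma> z
  obtain D where D: "countable D" "D \<subseteq> X" "X \<subseteq> closure D"
    using separable[of X] by blast
  have "D \<noteq> {}"
    using D(3) subspace_0[OF X(1)] by auto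
  define d where "d = from_nat_into D"
  have d: "range d = D"
    unfolding d_def using \<open>D \<noteq> {}\<close> D(1) by (rule range_from_nat_into)
  obtain N where N: "\<And>\<gamma>. \<gamma> \<in> space M - N \<Longrightarrow> coercive_symmetric_form (\<lambda>v w. a \<gamma> v w) \<alpha>"
    "N \<in> null_sets M"
    using AE_E3[OF AE_coercive_symmetric_form] by blast
  have [measurable]: "N \<in> sets M"
    using N(2) by blast
  have J_meas [measurable]: "(\<lambda>\<gamma>. J \<gamma> z) \<in> borel_measurable M" for z
  proof -
    have "(\<lambda>\<gamma>. a \<gamma> z z) \<in> borel_measurable M"
      using a unfolding bochner_Linf_def
      by (auto intro!: borel_measurable_blinfun_apply strongly_measurable_blinfun_apply
          strongly_measurable_const)
    moreover have "(\<lambda>\<gamma>. f \<gamma> z) \<in> borel_measurable M"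
      using f unfolding bochner_L2_def
      by (auto intro!: borel_measurable_blinfun_apply strongly_measurable_const)
    ultimately show ?thesis unfolding J_def by simp
  qed
  define P where "P n \<gamma> i \<longleftrightarrow> (\<forall>j. J \<gamma> (d i) \<le> J \<gamma> (d j) + inverse (real (Suc n)))" for n \<gamma> i
  have [measurable]: "Measurable.pred M (\<lambda>\<gamma>. P n \<gamma> i)" for n i
    unfolding P_def by measurable
  define s where "s n \<gamma> = (if \<gamma> \<in> N then 0 else d (LEAST i. P n \<gamma> i))" for n \<gamma>
  have [measurable]: "d \<in> measurable (count_space UNIV) borel"
    by simp
  have s_meas: "s n \<in> borel_measurable M" for n
    unfolding s_def by measurable
  have sol: "\<exists>w. w \<in> X \<and> (\<lambda>n. s n \<gamma>) \<longlonglongrightarrow> w \<and> (\<forall>z\<in>X. a \<gamma> w z = f \<gamma> z)"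
    if \<gamma>: "\<gamma> \<in> space M - N" for \<gamma>
  proof -
    interpret coercive_symmetric_form "\<lambda>v w. a \<gamma> v w" \<alpha>
      by (rule N(1)[OF \<gamma>])
    have J: "J \<gamma> = energy (f \<gamma>)"
      unfolding J_def energy_def by simp
    have P: "P n \<gamma> (LEAST i. P n \<gamma> i)" for n
    proof -
      obtain x where "x \<in> D" "\<And>z. z \<in> D \<Longrightarrow> energy (f \<gamma>) x < energy (f \<gamma>) z + inverse (real (Suc n))"
        using almost_minimizer_exists[OF \<open>D \<noteq> {}\<close>, of "inverse (real (Suc n))" "f \<gamma>"] by auto
      moreover from this obtain i where "x = d i"
        using d by blast
      ultimately have "P n \<gamma> i"
        unfolding P_def J using d by (auto intro: less_imp_le)
      then show ?thesis by (rule LeastI)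
    qed
    have sX: "s n \<gamma> \<in> X" for n
      using \<gamma> d D(2) unfolding s_def by auto
    have min: "energy (f \<gamma>) (s n \<gamma>) \<le> energy (f \<gamma>) z + inverse (real (Suc n))" if "z \<in> X" for n z
    proof -
      let ?S = "{z. energy (f \<gamma>) (s n \<gamma>) \<le> energy (f \<gamma>) z + inverse (real (Suc n))}"
      have "closed ?S"
        by (intro closed_Collect_le continuous_intros continuous_on_energy)
      moreover have "D \<subseteq> ?S"
        using P[of n] \<gamma> unfolding P_def J s_def d[symmetric] by auto
      ultimately have "closure D \<subseteq> ?S"
        by (simp add: closure_minimal)
      with D(3) that show ?thesis by auto
    qed
    show ?thesis
    proof (rule minimizing_sequence_converges[OF X sX min])
      fix w assume "w \<in> X" "(\<lambda>n. s n \<gamma>) \<longlonglongrightarrow> w"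
        and eq: "\<And>z. z \<in> X \<Longrightarrow> a \<gamma> w z = f \<gamma> z"
      moreover have "\<forall>z\<in>X. a \<gamma> w z = f \<gamma> z"
        by (intro ballI eq)
      ultimately show ?thesis by blast
    qed
  qed
  then obtain w0 where w0: "\<And>\<gamma>. \<gamma> \<in> space M - N \<Longrightarrow>
      w0 \<gamma> \<in> X \<and> (\<lambda>n. s n \<gamma>) \<longlonglongrightarrow> w0 \<gamma> \<and> (\<forall>z\<in>X. a \<gamma> (w0 \<gamma>) z = f \<gamma> z)"
    by metis
  define w where "w \<gamma> = (if \<gamma> \<in> N then 0 else w0 \<gamma>)" for \<gamma>
  have off_N: "AE \<gamma> in M. \<gamma> \<in> space M - N"
    using AE_not_in[OF N(2)] AE_space by eventually_elim auto
  have eq: "AE \<gamma> in M. \<forall>z\<in>X. a \<gamma> (w \<gamma>) z = f \<gamma> z"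
    using off_N by eventually_elim (use w0 in \<open>auto simp: w_def\<close>)
  have "w \<in> bochner_L2 M X"
  proof (rule bochner_L2_boundI)
    have "w \<in> borel_measurable M"
      using s_meas
    proof (rule borel_measurable_LIMSEQ_metric)
      show "(\<lambda>n. s n \<gamma>) \<longlonglongrightarrow> w \<gamma>" if "\<gamma> \<in> space M" for \<gamma>
        using w0[of \<gamma>] that by (cases "\<gamma> \<in> N") (auto simp: w_def s_def)
    qed
    then show "strongly_measurable M w"
      by (rule borel_measurable_imp_strongly_measurable)
    show wX: "AE \<gamma> in M. w \<gamma> \<in> X"
      using off_N by eventually_elim (use w0 in \<open>auto simp: w_def\<close>)
    show "integrable M (\<lambda>\<gamma>. (norm (f \<gamma>))\<^sup>2)"
      using f unfolding bochner_L2_def by blast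
    show "AE \<gamma> in M. norm (w \<gamma>) \<le> (1 / \<alpha>) * norm (f \<gamma>)"
      using eq wX AE_coercive_symmetric_form
    proof eventually_elim
      case (elim \<gamma>)
      then have "a \<gamma> (w \<gamma>) (w \<gamma>) = f \<gamma> (w \<gamma>)" by blast
      from coercive_symmetric_form.solution_bound[OF elim(3) this] show ?case by simp
    qed
  qed
  with eq that show ?thesis by blast
qed

lemma galerkin_solution_is_galerkin_solution:
  fixes f :: "'g \<Rightarrow> 'h \<Rightarrow>\<^sub>L real"
  assumes X: "subspace X" "closed X" and f: "f \<in> bochner_L2 M UNIV"
  shows "is_galerkin_solution M a f X (galerkin_solution M a f X)"
proof -
  obtain w where w: "w \<in> bochner_L2 M X" "AE \<gamma> in M. \<forall>z\<in>X. a \<gamma> (w \<gamma>) z = f \<gamma> z"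
    using pointwise_solution_exists[OF assms] by blast
  have "abar M a w z = (\<integral>\<gamma>. f \<gamma> (z \<gamma>) \<partial>M)" if z: "z \<in> bochner_L2 M X" for z
    unfolding abar_def
  proof (rule integral_cong_AE)
    show "(\<lambda>\<gamma>. a \<gamma> (w \<gamma>) (z \<gamma>)) \<in> borel_measurable M"
      using integrable_form[OF w(1) z] by simp
    show "(\<lambda>\<gamma>. f \<gamma> (z \<gamma>)) \<in> borel_measurable M"
      using integrable_duality_pairing[OF f z] by simp
    have "AE \<gamma> in M. z \<gamma> \<in> X"
      using z unfolding bochner_L2_def by blast
    with w(2) show "AE \<gamma> in M. a \<gamma> (w \<gamma>) (z \<gamma>) = f \<gamma> (z \<gamma>)"
      by eventually_elim blast
  qed
  with w(1) have "is_galerkin_solution M a f X w"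
    unfolding is_galerkin_solution_def by blast
  then show ?thesis
    unfolding galerkin_solution_def by (rule someI[of "is_galerkin_solution M a f X"])
qed

text \<open>With \<open>e = u - v\<close> and \<open>y = v - z\<close>, the error of \<open>z\<close> expands into the error of \<open>v\<close>, a mixed
  term that vanishes by Galerkin orthogonality, and the nonnegative square of \<open>y\<close>.\<close>

lemma galerkin_best_approximation:
  assumes u: "is_galerkin_solution M a f UNIV u" and v: "is_galerkin_solution M a f X v"
    and X: "subspace X" and z: "z \<in> bochner_L2 M X"
  shows "abar M a (\<lambda>\<gamma>. u \<gamma> - v \<gamma>) (\<lambda>\<gamma>. u \<gamma> - v \<gamma>) \<le> abar M a (\<lambda>\<gamma>. u \<gamma> - z \<gamma>) (\<lambda>\<gamma>. u \<gamma> - z \<gamma>)"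
proof -
  have uL: "u \<in> bochner_L2 M UNIV" and vL: "v \<in> bochner_L2 M X"
    using u v unfolding is_galerkin_solution_def by auto
  define e where "e \<gamma> = u \<gamma> - v \<gamma>" for \<gamma>
  define y where "y \<gamma> = v \<gamma> - z \<gamma>" for \<gamma>
  have y: "y \<in> bochner_L2 M X"
    using bochner_L2_diff[OF X vL z] unfolding y_def .
  have e: "e \<in> bochner_L2 M UNIV"
    using bochner_L2_diff[OF subspace_UNIV uL bochner_L2_mono[OF vL]] unfolding e_def by simp
  have yU: "y \<in> bochner_L2 M UNIV"
    using bochner_L2_mono[OF y] by simp
  have zL: "(\<lambda>\<gamma>. u \<gamma> - z \<gamma>) \<in> bochner_L2 M UNIV"
    using bochner_L2_diff[OF subspace_UNIV uL bochner_L2_mono[OF z]] by simp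
  have "abar M a e y = abar M a u y - abar M a v y"
    unfolding abar_def e_def
    using integrable_form[OF uL y] integrable_form[OF vL y] by (simp add: blinfun.bilinear_simps)
  also have "\<dots> = 0"
    using u v y yU unfolding is_galerkin_solution_def by simp
  finally have orth: "abar M a e y = 0" .
  have "abar M a e e = (\<integral>\<gamma>. a \<gamma> (e \<gamma>) (e \<gamma>) + 2 * a \<gamma> (e \<gamma>) (y \<gamma>) \<partial>M)"
    using orth integrable_form[OF e e] integrable_form[OF e y] unfolding abar_def by simp
  also have "\<dots> \<le> abar M a (\<lambda>\<gamma>. u \<gamma> - z \<gamma>) (\<lambda>\<gamma>. u \<gamma> - z \<gamma>)"
    unfolding abar_def
  proof (rule integral_mono_AE)
    show "integrable M (\<lambda>\<gamma>. a \<gamma> (e \<gamma>) (e \<gamma>) + 2 * a \<gamma> (e \<gamma>) (y \<gamma>))"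
      using integrable_form[OF e e] integrable_form[OF e y] by simp
    show "integrable M (\<lambda>\<gamma>. a \<gamma> (u \<gamma> - z \<gamma>) (u \<gamma> - z \<gamma>))"
      by (rule integrable_form[OF zL zL])
    show "AE \<gamma> in M. a \<gamma> (e \<gamma>) (e \<gamma>) + 2 * a \<gamma> (e \<gamma>) (y \<gamma>) \<le> a \<gamma> (u \<gamma> - z \<gamma>) (u \<gamma> - z \<gamma>)"
      using AE_coercive_symmetric_form
    proof eventually_elim
      case (elim \<gamma>)
      have "u \<gamma> - z \<gamma> = e \<gamma> + y \<gamma>"
        unfolding e_def y_def by simp
      then show ?case
        using coercive_symmetric_form.square_add[OF elim, of "e \<gamma>" "y \<gamma>"]
          coercive_symmetric_form.nonneg[OF elim, of "y \<gamma>"] by simp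
    qed
  qed
  finally show ?thesis unfolding e_def .
qed

section \<open>Existence of an optimal subspace\<close>

text \<open>The field \<open>w\<close> solves the pointwise problem in \<open>W\<close> with the functional \<open>a \<gamma> (u \<gamma>)\<close>, so that
  \<open>w \<gamma>\<close> is the best approximation of \<open>u \<gamma>\<close> in \<open>W\<close> at almost every \<open>\<gamma>\<close>, as the pointwise lower limit
  estimate requires.  Fatou's lemma then integrates that estimate.\<close>

lemma limit_of_minimizing_subspaces:
  assumes u: "u \<in> bochner_L2 M UNIV"
    and v: "\<And>n. v n \<in> bochner_L2 M (Z n)" and Z: "\<And>n. Z n \<in> subspaces_dim_le k"
    and lim: "(\<lambda>n. abar M a (\<lambda>\<gamma>. u \<gamma> - v n \<gamma>) (\<lambda>\<gamma>. u \<gamma> - v n \<gamma>)) \<longlonglongrightarrow> m"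
  obtains W w where "W \<in> subspaces_dim_le k" "w \<in> bochner_L2 M W"
    "abar M a (\<lambda>\<gamma>. u \<gamma> - w \<gamma>) (\<lambda>\<gamma>. u \<gamma> - w \<gamma>) \<le> m"
proof -
  have "\<forall>n. \<exists>e :: nat \<Rightarrow> 'h. (\<forall>i. norm (e i) \<le> 1) \<and> Z n = {z. z = (\<Sum>i<k. (z \<bullet> e i) *\<^sub>R e i)}"
    by (intro allI, rule subspaces_dim_le_expansion[OF Z]) blast
  from choice[OF this] obtain e :: "nat \<Rightarrow> nat \<Rightarrow> 'h" where e: "\<And>n i. norm (e n i) \<le> 1"
    "\<And>n. Z n = {z. z = (\<Sum>i<k. (z \<bullet> e n i) *\<^sub>R e n i)}"
    by blast
  obtain r l where r: "strict_mono (r :: nat \<Rightarrow> nat)"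
    and l: "\<And>i. i \<in> {..<k} \<Longrightarrow> weakly_converges (\<lambda>n. e (r n) i) (l i)"
    using weakly_convergent_subsequence[of "{..<k}" e] e(1) by blast
  define W where "W = span (l ` {..<k})"
  have W: "W \<in> subspaces_dim_le k"
    unfolding W_def by (rule span_in_subspaces_dim_le)
  obtain w where w: "w \<in> bochner_L2 M W" "AE \<gamma> in M. \<forall>z\<in>W. a \<gamma> (w \<gamma>) z = a \<gamma> (u \<gamma>) z"
    using pointwise_solution_exists[OF _ closed_subspaces_dim_le[OF W] form_apply_L2[OF u]]
    unfolding W_def by blast
  define err where "err x \<gamma> = a \<gamma> (u \<gamma> - x \<gamma>) (u \<gamma> - x \<gamma>)" for x \<gamma>
  have int: "integrable M (err x)" if "x \<in> bochner_L2 M X" for x X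
  proof -
    have "(\<lambda>\<gamma>. u \<gamma> - x \<gamma>) \<in> bochner_L2 M UNIV"
      using bochner_L2_diff[OF subspace_UNIV u bochner_L2_mono[OF that]] by simp
    then show ?thesis
      unfolding err_def by (intro integrable_form)
  qed
  have nonneg: "AE \<gamma> in M. 0 \<le> err x \<gamma>" for x
    using AE_form_nonneg by eventually_elim (simp add: err_def)
  have nn: "(\<integral>\<^sup>+\<gamma>. ennreal (err x \<gamma>) \<partial>M) = ennreal (abar M a (\<lambda>\<gamma>. u \<gamma> - x \<gamma>) (\<lambda>\<gamma>. u \<gamma> - x \<gamma>))"
    if "x \<in> bochner_L2 M X" for x X
    using nn_integral_eq_integral[OF int[OF that] nonneg] unfolding abar_def err_def .
  have vZ: "AE \<gamma> in M. \<forall>n. v (r n) \<gamma> \<in> Z (r n)"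
    using v unfolding AE_all_countable bochner_L2_def by blast
  have pointwise: "AE \<gamma> in M. ennreal (err w \<gamma>) \<le> liminf (\<lambda>n. ennreal (err (v (r n)) \<gamma>))"
  proof -
    have "AE \<gamma> in M. w \<gamma> \<in> W"
      using w(1) unfolding bochner_L2_def by blast
    with w(2) AE_coercive_symmetric_form vZ show ?thesis
    proof eventually_elim
      case (elim \<gamma>)
      have z: "v (r n) \<gamma> = (\<Sum>i<k. (v (r n) \<gamma> \<bullet> e (r n) i) *\<^sub>R e (r n) i)" for n
        using elim(3) e(2)[of "r n"] by blast
      show ?case
        unfolding err_def
        by (rule coercive_symmetric_form.best_approximation_error_le_liminf[OF elim(2),
              of "\<lambda>n. e (r n)" k l "\<lambda>n. v (r n) \<gamma>"])
          (use e(1) l z elim(1,4) in \<open>auto simp: W_def\<close>)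
    qed
  qed
  have "ennreal (abar M a (\<lambda>\<gamma>. u \<gamma> - w \<gamma>) (\<lambda>\<gamma>. u \<gamma> - w \<gamma>)) = (\<integral>\<^sup>+\<gamma>. ennreal (err w \<gamma>) \<partial>M)"
    using nn[OF w(1)] by simp
  also have "\<dots> \<le> (\<integral>\<^sup>+\<gamma>. liminf (\<lambda>n. ennreal (err (v (r n)) \<gamma>)) \<partial>M)"
    using pointwise by (rule nn_integral_mono_AE)
  also have "\<dots> \<le> liminf (\<lambda>n. \<integral>\<^sup>+\<gamma>. ennreal (err (v (r n)) \<gamma>) \<partial>M)"
    using int[OF v] by (intro nn_integral_liminf) simp
  also have "\<dots> = ennreal m"
  proof -
    have "(\<lambda>n. \<integral>\<^sup>+\<gamma>. ennreal (err (v (r n)) \<gamma>) \<partial>M) \<longlonglongrightarrow> ennreal m"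
      unfolding nn[OF v] using LIMSEQ_subseq_LIMSEQ[OF lim r]
      by (intro tendsto_ennrealI) (simp add: comp_def)
    then show ?thesis
      by (intro lim_imp_Liminf) auto
  qed
  finally have "ennreal (abar M a (\<lambda>\<gamma>. u \<gamma> - w \<gamma>) (\<lambda>\<gamma>. u \<gamma> - w \<gamma>)) \<le> ennreal m" .
  moreover have "0 \<le> m"
    using lim abar_nonneg by (intro LIMSEQ_le_const[OF lim]) auto
  ultimately show ?thesis
    using that[OF W w(1)] by (simp add: ennreal_le_iff)
qed

end

theorem theorem4p1:
  fixes M :: "'g measure"
    and a :: "'g \<Rightarrow> 'h::{real_inner, complete_space, second_countable_topology} \<Rightarrow>\<^sub>L 'h \<Rightarrow>\<^sub>L real"
    and f :: "'g \<Rightarrow> 'h \<Rightarrow>\<^sub>L real"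
    and \<alpha> :: real and k :: nat
    and u :: "'g \<Rightarrow> 'h" and u_sub :: "'h set \<Rightarrow> 'g \<Rightarrow> 'h"
  assumes "sigma_finite_measure M"
    and "a \<in> bochner_Linf M sym_bilinear_forms"
    and "\<alpha> > 0"
    and "AE \<gamma> in M. \<forall>v. \<alpha> * (norm v)\<^sup>2 \<le> a \<gamma> v v"
    and "f \<in> bochner_L2 M UNIV"
    and "k \<ge> 1"
    and "u = galerkin_solution M a f UNIV"
    and "u_sub = galerkin_solution M a f"
  shows "\<exists>W\<in>subspaces_dim_le k. \<forall>Z\<in>subspaces_dim_le k.
           abar M a (\<lambda>\<gamma>. u \<gamma> - u_sub W \<gamma>) (\<lambda>\<gamma>. u \<gamma> - u_sub W \<gamma>)
             \<le> abar M a (\<lambda>\<gamma>. u \<gamma> - u_sub Z \<gamma>) (\<lambda>\<gamma>. u \<gamma> - u_sub Z \<gamma>)"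
proof -
  interpret coercive_form_field M a \<alpha>
    by (rule coercive_form_field.intro) fact+
  define F where "F Z = abar M a (\<lambda>\<gamma>. u \<gamma> - u_sub Z \<gamma>) (\<lambda>\<gamma>. u \<gamma> - u_sub Z \<gamma>)" for Z
  let ?S = "subspaces_dim_le k :: 'h set set"
  have u: "is_galerkin_solution M a f UNIV u"
    unfolding assms(7) by (intro galerkin_solution_is_galerkin_solution assms) auto
  have sub: "subspace Z" if "Z \<in> ?S" for Z
    using that unfolding subspaces_dim_le_def by blast
  have u_sub: "is_galerkin_solution M a f Z (u_sub Z)" if "Z \<in> ?S" for Z
    unfolding assms(8)
    by (intro galerkin_solution_is_galerkin_solution assms sub[OF that] closed_subspaces_dim_le[OF that])
  have "?S \<noteq> {}"
    using span_in_subspaces_dim_le by blast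
  have bdd: "bdd_below (F ` ?S)"
    using abar_nonneg unfolding F_def by (meson bdd_belowI2)
  define m where "m = Inf (F ` ?S)"
  have m_le: "m \<le> F Z" if "Z \<in> ?S" for Z
    unfolding m_def using bdd that by (simp add: cINF_lower)
  have "\<exists>Z\<in>?S. F Z < m + inverse (real (Suc n))" for n
    using cInf_lessD[of "F ` ?S" "m + inverse (real (Suc n))"] \<open>?S \<noteq> {}\<close>
    unfolding m_def by auto
  then obtain Z where Z: "\<And>n. Z n \<in> ?S" "\<And>n. F (Z n) < m + inverse (real (Suc n))"
    by metis
  have "(\<lambda>n. F (Z n)) \<longlonglongrightarrow> m"
  proof (rule tendsto_sandwich)
    show "\<forall>\<^sub>F n in sequentially. m \<le> F (Z n)"
      using m_le Z(1) by simp
    show "\<forall>\<^sub>F n in sequentially. F (Z n) \<le> m + inverse (real (Suc n))"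
      using Z(2) by (intro always_eventually allI less_imp_le)
    show "(\<lambda>_. m) \<longlonglongrightarrow> m" by simp
    show "(\<lambda>n. m + inverse (real (Suc n))) \<longlonglongrightarrow> m"
      using tendsto_add[OF tendsto_const LIMSEQ_inverse_real_of_nat] by simp
  qed
  then obtain W w where W: "W \<in> ?S" "w \<in> bochner_L2 M W"
    "abar M a (\<lambda>\<gamma>. u \<gamma> - w \<gamma>) (\<lambda>\<gamma>. u \<gamma> - w \<gamma>) \<le> m"
    using limit_of_minimizing_subspaces[of u "\<lambda>n. u_sub (Z n)" Z k m] u u_sub Z(1)
    unfolding F_def is_galerkin_solution_def by blast
  have "F W \<le> m"
    using galerkin_best_approximation[OF u u_sub[OF W(1)] sub[OF W(1)] W(2)] W(3)
    unfolding F_def by simp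
  then show ?thesis
    using W(1) m_le unfolding F_def by (meson order_trans)
qed

end
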